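(* Let $x, y$ be nonnegative coprime integers which satisfy one of the following conditions: \begin{itemize} \item $y$ is odd and $\left(\frac{x}{y}\right)=-1$; \item $(x, y)\equiv (1, 0)\pmod{4}$ and $\left(\frac{x}{y}\right)=-1$; \item $(x, y)\equiv (3, 0)\pmod{4}$, and $\left(\frac{x}{y}\right)=-\left(\frac{-1}{y}\right)$. \end{itemize} Then the numerators and denominators of the orbit $\Psi\begin{pmatrix} x\\ y\end{pmatrix}$ cannot be squares.
   Context: $\left(\frac{x}{y}\right)$ denotes the Kronecker symbol. For a subset $\Gamma\subseteq\mathrm{SL}(2,\mathbb{Z})$, $\Gamma^{\geq 0}$ denotes the matrices in $\Gamma$ with all entries nonnegative. $\Gamma_1(4)=\{\begin{pmatrix} a & b\\ c & d\end{pmatrix}\in\mathrm{SL}(2,\mathbb{Z}): a\equiv d\equiv 1 \pmod 4,\ c\equiv 0\pmod 4\}$. The semigroup $\Psi$ is defined as the set of $\begin{pmatrix} a & b\\ c & d\end{pmatrix}\in\Gamma_1(4)^{\geq 0}$ such that for all nonnegative integers $x,y$ with $y$ odd, $\left(\frac{x}{y}\right)=\left(\frac{ax+by}{cx+dy}\right)$; equivalently, it is the set of such matrices with $\left(\frac{a}{b}\right)=1$. For a vector $\begin{pmatrix} u\\ v\end{pmatrix}$ in an orbit $\Psi\begin{pmatrix} x\\ y\end{pmatrix}=\{\gamma\begin{pmatrix} x\\ y\end{pmatrix}:\gamma\in\Psi\}$, $u$ is called the numerator and $v$ the denominator. *)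

theory Defs
  imports
    "HOL-Analysis.Analysis"
    "HOL-Number_Theory.Number_Theory"
    "HOL-Computational_Algebra.Nth_Powers"
begin

definition kronecker_two :: "int \<Rightarrow> int" where
  "kronecker_two a =
     (if even a then 0 else if a mod 8 = 1 \<or> a mod 8 = 7 then 1 else -1)"

text \<open>
  The Kronecker symbol $(a/n)$ for arbitrary integers. If $n = u p_1^{e_1} \cdots p_k^{e_k}$ with
  $u = \pm 1$, it is $(a/u) (a/p_1)^{e_1} \cdots (a/p_k)^{e_k}$, where $(a/1) = 1$, and $(a/-1)$ is
  $-1$ if $a < 0$ and $1$ otherwise. Moreover $(a/0)$ is $1$ if $a = \pm 1$ and $0$ otherwise.
  The elements of \<^term>\<open>prime_factors n\<close> are positive also when \<^term>\<open>n\<close> is negative.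
\<close>
definition kronecker :: "int \<Rightarrow> int \<Rightarrow> int" where
  "kronecker a n =
     (if n = 0 then (if \<bar>a\<bar> = 1 then 1 else 0)
      else (if n < 0 \<and> a < 0 then -1 else 1) *
           (\<Prod>p\<in>prime_factors n.
              (if p = 2 then kronecker_two a else Legendre a p) ^ multiplicity p n))"

definition SL2Z :: "(int^2^2) set" where
  "SL2Z = {A. det A = 1}"

definition nonneg_part :: "(int^2^2) set \<Rightarrow> (int^2^2) set" where
  "nonneg_part \<Gamma> = {A \<in> \<Gamma>. \<forall>i j. A $ i $ j \<ge> 0}"

definition Gamma1_4 :: "(int^2^2) set" where
  "Gamma1_4 = {A \<in> SL2Z. [A $ 1 $ 1 = 1] (mod 4) \<and> [A $ 2 $ 2 = 1] (mod 4) \<and>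
                         [A $ 2 $ 1 = 0] (mod 4)}"

definition Psi :: "(int^2^2) set" where
  "Psi = {A \<in> nonneg_part Gamma1_4.
            \<forall>x y. x \<ge> 0 \<and> y \<ge> 0 \<and> odd y \<longrightarrow>
              kronecker x y =
              kronecker (A $ 1 $ 1 * x + A $ 1 $ 2 * y) (A $ 2 $ 1 * x + A $ 2 $ 2 * y)}"

definition orbit :: "(int^2^2) set \<Rightarrow> int^2 \<Rightarrow> (int^2) set" where
  "orbit S v = {A *v v | A. A \<in> S}"

definition numerator :: "int^2 \<Rightarrow> int" where
  "numerator w = w $ 1"

definition denominator :: "int^2 \<Rightarrow> int" where
  "denominator w = w $ 2"

end

theory Submission
  imports Defs
begin

text \<open>
  For odd \<open>y\<close> the orbit preserves \<open>(x/y) = -1\<close> by definition of \<open>\<Psi>\<close>, and the symbol of a pair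
  with a square entry is never \<open>-1\<close>. If \<open>4\<close> divides \<open>y\<close>, the invariance is not available for
  \<open>(x, y)\<close>, so one passes to a second column: choose \<open>s, t \<ge> 0\<close> with \<open>x t - s y = 1\<close>. Then \<open>t\<close>
  is odd, so \<open>(s/t)\<close> is preserved. Moreover \<open>(x/y) = (t/y)\<close>, quadratic reciprocity turns
  \<open>(t/y)\<close> into \<open>(y/t)\<close>, and \<open>(s/t) (y/t) = (-1/t)\<close>; so \<open>(s/t)\<close> determines \<open>(x/y)\<close>, up to the factor
  \<open>(-1/y)\<close> when \<open>x\<close> is \<open>3\<close> modulo \<open>4\<close>. The same relations hold for the image pair.
\<close>

section \<open>The Kronecker symbol\<close>

definition kronecker_prime :: "int \<Rightarrow> int \<Rightarrow> int" where
  "kronecker_prime a p = (if p = 2 then kronecker_two a else Legendre a p)"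

text \<open>Positivity of \<open>n\<close> removes the sign factor, and repeating each prime by its
  multiplicity absorbs the powers. Multiplicativity in either argument can then be read off factor
  by factor.\<close>

lemma kronecker_eq_prod_mset:
  assumes "n > 0"
  shows "kronecker a n = (\<Prod>p\<in>#prime_factorization n. kronecker_prime a p)"
  using assms unfolding kronecker_def kronecker_prime_def image_prod_mset_multiplicity
  by (auto intro!: prod.cong simp: count_prime_factorization_prime in_prime_factors_imp_prime)

lemma kronecker_one_right [simp]: "kronecker a 1 = 1"
  by (simp add: kronecker_eq_prod_mset)

lemma kronecker_prime_right:
  assumes "prime p"
  shows "kronecker a p = kronecker_prime a p"
  using assms by (simp add: kronecker_eq_prod_mset prime_gt_0_int prime_factorization_prime)

lemma kronecker_mult_right:
  assumes "m > 0" "n > 0"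
  shows "kronecker a (m * n) = kronecker a m * kronecker a n"
  using assms by (simp add: kronecker_eq_prod_mset prime_factorization_mult)

lemma odd_prime_gt_2_int:
  fixes p :: int
  assumes "prime p" "p \<noteq> 2"
  shows "p > 2"
  using assms prime_ge_2_int[of p] by simp

text \<open>Euler's criterion makes both sides congruent modulo \<open>p\<close>; as both lie in
  {-1, 0, 1}, they differ by at most 2, which is less than \<open>p\<close>.\<close>

lemma Legendre_mult:
  assumes "prime p" "p > 2"
  shows "Legendre (a * b) p = Legendre a p * Legendre b p"
proof -
  have euler: "[Legendre c p = c ^ ((nat p - 1) div 2)] (mod p)" for c
    using euler_criterion[of "nat p" c] assms by simp
  have "[Legendre (a * b) p = Legendre a p * Legendre b p] (mod p)"
    using cong_mult[OF euler[of a] euler[of b]] euler[of "a * b"]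
    by (simp add: power_mult_distrib cong_def)
  then have "p dvd Legendre (a * b) p - Legendre a p * Legendre b p"
    by (simp add: cong_iff_dvd_diff)
  moreover have "\<bar>Legendre (a * b) p - Legendre a p * Legendre b p\<bar> \<le> 2"
    by (simp add: Legendre_def)
  ultimately show ?thesis
    using assms(2) zdvd_imp_le[of p "\<bar>Legendre (a * b) p - Legendre a p * Legendre b p\<bar>"] by force
qed

lemma mod_8_cases: "(c :: int) mod 8 \<in> {0, 1, 2, 3, 4, 5, 6, 7}"
proof -
  have "r \<in> {0, 1, 2, 3, 4, 5, 6, 7}" if "0 \<le> r" "r < 8" for r :: int
    using that by (simp; presburger)
  then show ?thesis by (meson pos_mod_bound pos_mod_sign zero_less_numeral)
qed

text \<open>The value depends only on the residue modulo 8, so a finite check over pairs of residues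
  suffices.\<close>

lemma kronecker_two_mult: "kronecker_two (a * b) = kronecker_two a * kronecker_two b"
proof -
  have mod_8: "kronecker_two c = kronecker_two (c mod 8)" for c
  proof -
    have "even (c mod 8) \<longleftrightarrow> even c" by presburger
    then show ?thesis by (simp add: kronecker_two_def)
  qed
  have residues: "\<forall>r\<in>{0, 1, 2, 3, 4, 5, 6, 7}. \<forall>s\<in>{0, 1, 2, 3, 4, 5, 6, 7}.
      kronecker_two (r * s mod 8) = kronecker_two r * kronecker_two s"
    by (simp add: kronecker_two_def)
  have "kronecker_two (a * b) = kronecker_two ((a mod 8) * (b mod 8) mod 8)"
    using mod_8[of "a * b"] by (simp add: mod_mult_eq)
  also have "\<dots> = kronecker_two (a mod 8) * kronecker_two (b mod 8)"
    by (rule bspec[OF bspec[OF residues mod_8_cases] mod_8_cases])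
  finally show ?thesis by (simp flip: mod_8)
qed

lemma kronecker_prime_mult:
  assumes "prime p"
  shows "kronecker_prime (a * b) p = kronecker_prime a p * kronecker_prime b p"
  using assms odd_prime_gt_2_int
  by (simp add: kronecker_prime_def kronecker_two_mult Legendre_mult)

lemma kronecker_mult_left:
  assumes "n > 0"
  shows "kronecker (a * b) n = kronecker a n * kronecker b n"
  using assms
  by (simp add: kronecker_eq_prod_mset kronecker_prime_mult in_prime_factors_imp_prime
      flip: prod_mset.distrib cong: image_mset_cong)

lemma pos_prime_divisors_induct [consumes 1, case_names one factor]:
  fixes n :: int
  assumes "n > 0" "P 1"
    and "\<And>p m. \<lbrakk>prime p; m > 0; P m\<rbrakk> \<Longrightarrow> P (p * m)"
  shows "P n"
  using assms(1)
proof (induction n rule: prime_divisors_induct)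
  case (unit x)
  then show ?case using assms(2) by (auto simp: zdvd1_eq abs_if split: if_splits)
next
  case (factor p x)
  then show ?case using assms(3)[of p x] prime_gt_0_int[of p] by (simp add: zero_less_mult_iff)
qed auto

lemma odd_pos_prime_divisors_induct [consumes 2, case_names one factor]:
  fixes n :: int
  assumes "n > 0" "odd n" "P 1"
    and "\<And>p m. \<lbrakk>prime p; p > 2; odd p; m > 0; odd m; P m\<rbrakk> \<Longrightarrow> P (p * m)"
  shows "P n"
  using assms(1,2)
proof (induction n rule: pos_prime_divisors_induct)
  case (factor p m)
  then show ?case using assms(4)[of p m] odd_prime_gt_2_int[of p] by (cases "p = 2") auto
qed (use assms(3) in auto)

lemma kronecker_odd_prime_right:
  assumes "prime p" "p > 2"
  shows "kronecker a p = Legendre a p"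
  using assms by (simp add: kronecker_prime_right kronecker_prime_def)

lemma Legendre_cong:
  assumes "[a = b] (mod p)"
  shows "Legendre a p = Legendre b p"
  using assms unfolding Legendre_def QuadRes_def cong_def by simp

text \<open>A congruence modulo \<open>n\<close> passes to each prime factor, and the Legendre
  symbol at an odd prime sees only the residue modulo that prime. The factor at 2 depends on the
  residue modulo 8, hence the restriction to odd \<open>n\<close>.\<close>

lemma kronecker_cong_left:
  assumes "n > 0" "odd n" "[a = b] (mod n)"
  shows "kronecker a n = kronecker b n"
  using assms
proof (induction n rule: odd_pos_prime_divisors_induct)
  case (factor p m)
  have "[a = b] (mod p)" "[a = b] (mod m)"
    using factor.prems cong_dvd_modulus by (meson dvd_triv_left dvd_triv_right)+
  with factor Legendre_cong[of a b p] show ?case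
    by (simp add: kronecker_mult_right kronecker_odd_prime_right)
qed simp

lemma Legendre_one_left:
  assumes "p > 2"
  shows "Legendre 1 p = 1"
proof -
  have "QuadRes p 1" unfolding QuadRes_def by (rule exI[of _ 1]) simp
  moreover have "\<not> [1 = 0] (mod p)" using assms by (simp add: cong_def)
  ultimately show ?thesis by (simp add: Legendre_def)
qed

lemma kronecker_one_left:
  assumes "n > 0"
  shows "kronecker 1 n = 1"
  using assms
proof (induction n rule: pos_prime_divisors_induct)
  case (factor p m)
  then show ?case
    using odd_prime_gt_2_int[of p] Legendre_one_left[of p] prime_gt_0_int[of p]
    by (simp add: kronecker_mult_right kronecker_prime_right kronecker_prime_def kronecker_two_def)
qed simp

lemma kronecker_minus_one_prime:
  fixes p :: int
  assumes "prime p" "p > 2"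
  shows "kronecker (-1) p = (if p mod 4 = 1 then 1 else -1)"
proof -
  have odd: "odd p" using assms prime_odd_int by blast
  have "[Legendre (-1) p = (-1) ^ ((nat p - 1) div 2)] (mod p)"
    using euler_criterion[of "nat p" "-1"] assms by simp
  then have "p dvd Legendre (-1) p - (-1) ^ ((nat p - 1) div 2)"
    by (simp add: cong_iff_dvd_diff)
  moreover have "\<bar>Legendre (-1) p - (-1) ^ ((nat p - 1) div 2)\<bar> \<le> 2"
    by (cases "even ((nat p - 1) div 2)") (simp_all add: Legendre_def)
  ultimately have "Legendre (-1) p = (-1) ^ ((nat p - 1) div 2)"
    using assms(2) zdvd_imp_le[of p "\<bar>Legendre (-1) p - (-1) ^ ((nat p - 1) div 2)\<bar>"] by force
  moreover have "even ((nat p - 1) div 2) \<longleftrightarrow> p mod 4 = 1"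
  proof -
    have "(nat p - 1) div 2 = nat ((p - 1) div 2)" by fastforce
    moreover have "even ((p - 1) div 2) \<longleftrightarrow> p mod 4 = 1" using odd by presburger
    ultimately show ?thesis using assms(2) by (simp add: even_nat_iff)
  qed
  ultimately show ?thesis
    using assms by (simp add: kronecker_odd_prime_right minus_one_power_iff)
qed

lemma odd_mult_mod_4:
  fixes m n :: int
  assumes "odd m" "odd n"
  shows "m * n mod 4 = (if m mod 4 = n mod 4 then 1 else 3)"
proof -
  have "m mod 4 = 1 \<or> m mod 4 = 3" "n mod 4 = 1 \<or> n mod 4 = 3" using assms by presburger+
  moreover have "m * n mod 4 = ((m mod 4) * (n mod 4)) mod 4" by (simp add: mod_mult_eq)
  ultimately show ?thesis by (elim disjE) simp_all
qed

lemma odd_mod_4: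
  fixes n :: int
  assumes "odd n"
  shows "n mod 4 = 1 \<or> n mod 4 = 3"
  using assms by presburger

lemma kronecker_minus_one:
  assumes "n > 0" "odd n"
  shows "kronecker (-1) n = (if n mod 4 = 1 then 1 else -1)"
  using assms
proof (induction n rule: odd_pos_prime_divisors_induct)
  case (factor p m)
  then show ?case
    using odd_mod_4[of p] odd_mod_4[of m]
    by (auto simp: kronecker_mult_right kronecker_minus_one_prime odd_mult_mod_4)
qed simp

section \<open>Reciprocity\<close>

lemma kronecker_reciprocity_prime:
  assumes "prime p" "p > 2" "prime q" "q > 2"
  shows "kronecker p q = kronecker q p * (if p mod 4 = 3 \<and> q mod 4 = 3 then -1 else 1)"
proof (cases "p = q")
  case True
  have "Legendre p p = 0" by (simp add: Legendre_def cong_def)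
  with True assms show ?thesis by (simp add: kronecker_odd_prime_right)
next
  case False
  have odd: "odd p" "odd q" using assms prime_odd_int by blast+
  have "Legendre p q * Legendre q p = (-1) ^ (nat ((p - 1) div 2 * ((q - 1) div 2)))"
    using Quadratic_Reciprocity_int[of p q] assms False by simp
  moreover have "even (nat ((p - 1) div 2 * ((q - 1) div 2))) \<longleftrightarrow> \<not> (p mod 4 = 3 \<and> q mod 4 = 3)"
  proof -
    have "(p - 1) div 2 * ((q - 1) div 2) \<ge> 0" using assms by simp
    moreover have "even ((p - 1) div 2) \<longleftrightarrow> p mod 4 \<noteq> 3" "even ((q - 1) div 2) \<longleftrightarrow> q mod 4 \<noteq> 3"
      using odd by presburger+
    ultimately show ?thesis by (simp add: even_nat_iff)
  qed
  ultimately have "Legendre p q * Legendre q p = (if p mod 4 = 3 \<and> q mod 4 = 3 then -1 else 1)"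
    by (simp add: minus_one_power_iff)
  \<comment> \<open>The product of the two symbols is 1 or -1, so each is its own inverse and can
    change sides.\<close>
  then show ?thesis
    using assms by (auto simp: kronecker_odd_prime_right Legendre_def split: if_splits)
qed

text \<open>Reciprocity is extended from primes one argument at a time. The sign is multiplicative
  because the odd residues modulo 4 form a group of order two.\<close>

lemma kronecker_reciprocity_prime_odd:
  assumes "prime p" "p > 2" "n > 0" "odd n"
  shows "kronecker p n = kronecker n p * (if p mod 4 = 3 \<and> n mod 4 = 3 then -1 else 1)"
  using assms(3,4)
proof (induction n rule: odd_pos_prime_divisors_induct)
  case one
  then show ?case using assms by (simp add: kronecker_one_left)
next
  case (factor q m)
  then show ?case
    using assms kronecker_reciprocity_prime[OF assms(1,2) factor.hyps(1,2)]
      odd_mod_4[of q] odd_mod_4[of m]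
    by (auto simp: kronecker_mult_right kronecker_mult_left odd_mult_mod_4)
qed

theorem kronecker_reciprocity_odd:
  assumes "m > 0" "odd m" "n > 0" "odd n"
  shows "kronecker m n = kronecker n m * (if m mod 4 = 3 \<and> n mod 4 = 3 then -1 else 1)"
  using assms(1,2)
proof (induction m rule: odd_pos_prime_divisors_induct)
  case one
  then show ?case using assms by (simp add: kronecker_one_left)
next
  case (factor q k)
  have "(if q * k mod 4 = 3 \<and> n mod 4 = 3 then -1 else 1 :: int) =
      (if q mod 4 = 3 \<and> n mod 4 = 3 then -1 else 1) * (if k mod 4 = 3 \<and> n mod 4 = 3 then -1 else 1)"
    using odd_mod_4[OF factor.hyps(3)] odd_mod_4[OF factor.hyps(5)]
    by (auto simp: odd_mult_mod_4 factor.hyps)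
  then show ?case
    using factor.hyps assms(3) factor.IH
      kronecker_reciprocity_prime_odd[OF factor.hyps(1,2) assms(3,4)]
    by (simp only: kronecker_mult_right kronecker_mult_left prime_gt_0_int ac_simps)
qed

text \<open>
  The second supplement follows from reciprocity for \<open>n\<close> and \<open>n - 2\<close>, one of which is \<open>1\<close> modulo
  \<open>4\<close>: \<open>(-2/n) = ((n-2)/n) = (n/(n-2)) = (2/(n-2))\<close>.
\<close>
lemma kronecker_two_left:
  assumes "n > 0" "odd n"
  shows "kronecker 2 n = kronecker_two n"
  using assms
proof (induction "nat n" arbitrary: n rule: less_induct)
  case less
  show ?case
  proof (cases "n = 1")
    case True
    then show ?thesis by (simp add: kronecker_two_def)
  next
    case False
    with less.prems have n: "n > 2" "n - 2 > 0" "odd (n - 2)" by presburger+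
    have "kronecker (-1) n * kronecker 2 n = kronecker (n - 2) n"
      using less.prems kronecker_cong_left[of n "-2" "n - 2"]
      by (simp add: cong_def flip: kronecker_mult_left)
    also have "\<dots> = kronecker n (n - 2)"
    proof -
      have one: "\<not> ((n - 2) mod 4 = 3 \<and> n mod 4 = 3)" by presburger
      show ?thesis
        using kronecker_reciprocity_odd[OF n(2,3) less.prems] unfolding if_not_P[OF one] by simp
    qed
    also have "\<dots> = kronecker 2 (n - 2)"
      using n by (intro kronecker_cong_left) (simp_all add: cong_iff_dvd_diff)
    also have "\<dots> = kronecker_two (n - 2)"
      using less.hyps[of "n - 2"] n by simp
    finally have *: "kronecker (-1) n * kronecker 2 n = kronecker_two (n - 2)" .
    \<comment> \<open>These equivalences express all three symbols in \<open>*\<close> through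
      \<open>n mod 8\<close>, leaving four odd residues to compare.\<close>
    have "\<forall>r\<in>{0, 1, 2, 3, 4, 5, 6, 7 :: int}. ((r - 2) mod 8 = 1 \<longleftrightarrow> r = 3) \<and>
        ((r - 2) mod 8 = 7 \<longleftrightarrow> r = 1) \<and> (r mod 4 = 1 \<longleftrightarrow> r = 1 \<or> r = 5)"
      by simp
    note bspec[OF this mod_8_cases[of n]]
    moreover have "(n mod 8 - 2) mod 8 = (n - 2) mod 8" "n mod 8 mod 4 = n mod 4"
      by (simp_all add: mod_diff_left_eq mod_mod_cancel)
    ultimately have mods: "(n - 2) mod 8 = 1 \<longleftrightarrow> n mod 8 = 3" "(n - 2) mod 8 = 7 \<longleftrightarrow> n mod 8 = 1"
      "n mod 4 = 1 \<longleftrightarrow> n mod 8 = 1 \<or> n mod 8 = 5"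
      by (simp_all only:)
    have residues: "kronecker_two n = (if n mod 8 = 1 \<or> n mod 8 = 7 then 1 else -1)"
      "kronecker_two (n - 2) = (if n mod 8 = 3 \<or> n mod 8 = 1 then 1 else -1)"
      "kronecker (-1) n = (if n mod 8 = 1 \<or> n mod 8 = 5 then 1 else -1)"
      using less.prems(2) n(3)
      by (simp_all only: kronecker_two_def kronecker_minus_one[OF less.prems] mods if_False)
    have "n mod 8 = 1 \<or> n mod 8 = 3 \<or> n mod 8 = 5 \<or> n mod 8 = 7"
      using less.prems(2) by presburger
    then show ?thesis
      using * unfolding residues by (elim disjE) simp_all
  qed
qed

text \<open>This form also covers even \<open>n\<close>. Both sides are multiplicative in
  \<open>n\<close>; at the prime 2 the claim is the second supplement, since
  \<open>kronecker (-1) 2 = 1\<close>.\<close>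

theorem kronecker_reciprocity:
  assumes "m > 0" "odd m" "n > 0"
  shows "kronecker m n = kronecker n m * (if m mod 4 = 1 then 1 else kronecker (-1) n)"
  using assms(3)
proof (induction n rule: pos_prime_divisors_induct)
  case one
  then show ?case using assms by (simp add: kronecker_one_left)
next
  case (factor p n)
  have "kronecker m p = kronecker p m * (if m mod 4 = 1 then 1 else kronecker (-1) p)"
  proof (cases "p = 2")
    case True
    then show ?thesis
      using assms
      by (simp add: kronecker_two_left kronecker_prime_right kronecker_prime_def kronecker_two_def)
  next
    case False
    with factor have "p > 2" "odd p" using odd_prime_gt_2_int prime_odd_int by blast+
    then show ?thesis
      using kronecker_reciprocity_odd[of m p] assms factor.hyps odd_mod_4[of m] odd_mod_4[of p]
      by (auto simp: kronecker_minus_one_prime)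
  qed
  with factor assms prime_gt_0_int[of p] show ?case
    by (simp add: kronecker_mult_right kronecker_mult_left)
qed

section \<open>Squares and second columns\<close>

lemma kronecker_square_left_nonneg:
  assumes "n > 0" "is_square a"
  shows "kronecker a n \<ge> 0"
  using assms by (auto simp: is_nth_power_def power2_eq_square kronecker_mult_left)

lemma kronecker_square_right_nonneg:
  assumes "n > 0" "is_square n"
  shows "kronecker a n \<ge> 0"
proof -
  from assms(2) obtain k where "n = k ^ 2" by (auto simp: is_nth_power_def)
  \<comment> \<open>The root is made positive because multiplicativity in the lower argument is
    available for positive factors.\<close>
  then have "n = \<bar>k\<bar> * \<bar>k\<bar>" by (simp add: power2_eq_square)
  moreover from this assms(1) have "\<bar>k\<bar> > 0" by auto
  ultimately show ?thesis by (simp add: kronecker_mult_right del: abs_mult_self)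
qed

text \<open>Odd primes dividing \<open>n\<close> see the numerator as 1. At the prime 2, either 8
  divides \<open>n\<close> and the numerator is 1 modulo 8, or \<open>n = 4 * m\<close> with
  \<open>m\<close> odd and the factor at 2 occurs squared.\<close>

lemma kronecker_one_plus_multiple:
  assumes "n > 0" "4 dvd n"
  shows "kronecker (1 + s * n) n = 1"
proof -
  have Legendre: "Legendre (1 + s * n) p = 1" if "p dvd n" "p > 2" for p
    using that Legendre_cong[of "1 + s * n" 1 p] Legendre_one_left
    by (simp add: cong_iff_dvd_diff)
  show ?thesis
  proof (cases "8 dvd n")
    case True
    then have "8 dvd s * n" by simp
    then have "(1 + s * n) mod 8 = 1" by presburger
    moreover have "odd c" if "c mod 8 = 1" for c :: int using that by presburger
    ultimately have "kronecker_two (1 + s * n) = 1" unfolding kronecker_two_def by metis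
    then have "kronecker_prime (1 + s * n) p = 1" if "p \<in># prime_factorization n" for p
      using that Legendre[of p] odd_prime_gt_2_int[of p]
      by (auto simp: kronecker_prime_def in_prime_factors_iff)
    then show ?thesis
      using assms by (simp add: kronecker_eq_prod_mset cong: image_mset_cong)
  next
    case False
    from assms(2) obtain m where m: "n = 4 * m" by auto
    with False assms have modd: "odd m" "m > 0" by auto
    have "kronecker (1 + s * n) n = (kronecker (1 + s * n) 2) ^ 2 * kronecker (1 + s * n) m"
      using modd kronecker_mult_right[of 4 m] kronecker_mult_right[of 2 2] m
      by (simp add: power2_eq_square)
    also have "(kronecker (1 + s * n) 2) ^ 2 = 1"
      using m by (simp add: kronecker_prime_right kronecker_prime_def kronecker_two_def)
    also have "kronecker (1 + s * n) m = kronecker 1 m"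
      using modd m by (intro kronecker_cong_left) (simp_all add: cong_iff_dvd_diff)
    finally show ?thesis using modd by (simp add: kronecker_one_left)
  qed
qed

lemma kronecker_eq_if_mult_eq_one:
  assumes "n > 0" "kronecker (a * b) n = 1"
  shows "kronecker a n = kronecker b n"
  using assms by (auto simp: kronecker_mult_left zmult_eq_1_iff)

lemma kronecker_minus_one_square:
  assumes "n > 0"
  shows "kronecker (-1) n * kronecker (-1) n = 1"
  using kronecker_mult_left[OF assms, of "-1" "-1"] kronecker_one_left[OF assms] by simp

text \<open>Trades a denominator divisible by 4 for the odd denominator \<open>t\<close>, where
  invariance under \<open>Psi\<close> is available. The hypothesis says that the columns
  \<open>(x, y)\<close> and \<open>(s, t)\<close> form a matrix of determinant 1.\<close>

lemma kronecker_eq_second_column: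
  assumes "y > 0" "4 dvd y" "t > 0" "x * t - s * y = 1"
  shows "kronecker x y = (if t mod 4 = 1 then 1 else - kronecker (-1) y) * kronecker s t"
proof -
  have xt: "x * t = 1 + s * y" using assms(4) by simp
  have "even y" using assms(2) by presburger
  with xt have "odd (x * t)" by simp
  then have "odd t" by simp
  have "kronecker x y = kronecker t y"
    using kronecker_eq_if_mult_eq_one[OF assms(1), of x t]
      kronecker_one_plus_multiple[OF assms(1,2), of s] xt by simp
  also have "\<dots> = kronecker y t * (if t mod 4 = 1 then 1 else kronecker (-1) y)"
    using kronecker_reciprocity assms(1,3) \<open>odd t\<close> by blast
  also have "kronecker y t = kronecker s t * (if t mod 4 = 1 then 1 else -1)"
  proof -
    \<comment> \<open>The determinant condition gives that \<open>s * y\<close> is -1 modulo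
      \<open>t\<close>.\<close>
    have prod: "kronecker s t * kronecker y t = (if t mod 4 = 1 then 1 else -1)"
      using kronecker_cong_left[OF assms(3) \<open>odd t\<close>, of "s * y" "-1"] xt assms(3) \<open>odd t\<close>
      by (simp add: kronecker_minus_one cong_iff_dvd_diff add.commute flip: kronecker_mult_left)
        (metis dvd_triv_right)
    have "\<bar>kronecker s t * kronecker y t\<bar> = 1" using prod by simp
    then have "\<bar>kronecker s t\<bar> = 1" by (metis abs_mult abs_zmult_eq_1)
    then show ?thesis using prod by (auto simp: abs_if split: if_splits)
  qed
  finally show ?thesis by auto
qed

lemma exists_second_column:
  fixes x y :: int
  assumes "x > 0" "y > 1" "coprime x y"
  obtains s t where "s \<ge> 0" "t > 0" "x * t - s * y = 1"
proof -
  obtain t0 where t0: "[x * t0 = 1] (mod y)"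
    using assms(3) cong_solve_coprime_int by blast
  \<comment> \<open>Reducing the inverse of \<open>x\<close> modulo \<open>y\<close> makes it
    nonnegative; \<open>y > 1\<close> then excludes 0.\<close>
  define t where "t = t0 mod y"
  have t: "[x * t = 1] (mod y)" using t0 by (simp add: t_def cong_def mod_mult_right_eq)
  have "t \<noteq> 0" using t assms(2) by (auto simp: cong_def)
  moreover have "t \<ge> 0" using assms(2) by (simp add: t_def)
  ultimately have "t > 0" by simp
  from t obtain s where s: "x * t - 1 = y * s" by (auto simp: cong_iff_dvd_diff)
  have "x * t > 0" using assms(1) \<open>t > 0\<close> by simp
  then have "y * s \<ge> 0" using s by linarith
  then have "s \<ge> 0" using assms(2) by (simp add: zero_le_mult_iff)
  then show thesis using that[of s t] \<open>t > 0\<close> s by (simp add: algebra_simps)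
qed

lemma square_mod_4:
  fixes a :: int
  assumes "is_square a"
  shows "a mod 4 \<noteq> 3"
proof -
  from assms obtain k where "a = k * k" by (auto simp: is_nth_power_def power2_eq_square)
  then show ?thesis using odd_mult_mod_4[of k k] by (cases "even k") auto
qed

section \<open>Orbits of matrices in \<open>\<Psi>\<close>\<close>

text \<open>Membership in \<open>Psi\<close> spelled out for the four entries, so that the orbit is
  computed with integers instead of matrices.\<close>

locale Psi_matrix =
  fixes a b c d :: int
  assumes nonneg: "a \<ge> 0" "b \<ge> 0" "c \<ge> 0" "d \<ge> 0"
    and det: "a * d - b * c = 1"
    and mod_4: "[a = 1] (mod 4)" "[d = 1] (mod 4)" "[c = 0] (mod 4)"
    and kronecker_invariant:
      "\<And>x y. \<lbrakk>x \<ge> 0; y \<ge> 0; odd y\<rbrakk> \<Longrightarrow> kronecker x y = kronecker (a * x + b * y) (c * x + d * y)"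
begin

lemma d_pos: "d > 0"
  using nonneg mod_4 by (cases "d = 0") (auto simp: cong_def)

lemma denominator_pos:
  assumes "x \<ge> 0" "y > 0"
  shows "c * x + d * y > 0"
  using assms nonneg d_pos by (intro add_nonneg_pos) auto

lemma denominator_mod_4: "(c * x + d * y) mod 4 = y mod 4"
proof -
  have "[c * x + d * y = 0 * x + 1 * y] (mod 4)"
    using mod_4 by (intro cong_add cong_mult) auto
  then show ?thesis by (simp add: cong_def)
qed

text \<open>The entry \<open>b\<close> is arbitrary modulo 4, so its contribution vanishes only
  through the divisibility of \<open>y\<close>.\<close>

lemma numerator_mod_4:
  assumes "4 dvd y"
  shows "(a * x + b * y) mod 4 = x mod 4"
proof -
  have "[a * x + b * y = 1 * x + b * 0] (mod 4)"
    using mod_4 assms by (intro cong_add cong_mult) (auto simp: cong_0_iff)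
  then show ?thesis by (simp add: cong_def)
qed

text \<open>Multiplication by the matrix keeps the determinant of the two columns, so
  \<open>kronecker_eq_second_column\<close> applies before and after. Both
  \<open>kronecker s t\<close> and \<open>t mod 4\<close> are preserved, and \<open>t\<close> agrees
  with \<open>x\<close> modulo 4.\<close>

lemma kronecker_orbit_four_dvd:
  assumes "x > 0" "y > 0" "4 dvd y" "coprime x y"
    and u: "u = a * x + b * y" and v: "v = c * x + d * y"
  shows "x mod 4 = 1 \<Longrightarrow> kronecker u v = kronecker x y"
    and "x mod 4 = 3 \<Longrightarrow> kronecker x y = - kronecker (-1) y \<Longrightarrow> kronecker u v = - kronecker (-1) v"
proof -
  have "y > 1" using assms(2,3) by presburger
  then obtain s t where st: "s \<ge> 0" "t > 0" "x * t - s * y = 1"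
    using exists_second_column assms(1,4) by metis
  define s' t' where "s' = a * s + b * t" and "t' = c * s + d * t"
  have xt1: "x * t = 1 + s * y" using st by simp
  moreover have "4 dvd s * y" using assms(3) by simp
  ultimately have "x * t mod 4 = 1" by presburger
  have "even y" using assms(3) by presburger
  with xt1 have "odd (x * t)" by simp
  then have "odd x" "odd t" by auto
  with odd_mult_mod_4[of x t] \<open>x * t mod 4 = 1\<close> have xt: "t mod 4 = x mod 4"
    by (auto split: if_splits)
  have inv: "kronecker s' t' = kronecker s t"
    using kronecker_invariant[of s t] st \<open>odd t\<close> by (simp add: s'_def t'_def)
  have t': "t' > 0" "t' mod 4 = t mod 4"
    using denominator_pos denominator_mod_4 st by (auto simp: t'_def)
  have v4: "v > 0" "4 dvd v"
  proof -
    show "v > 0" using denominator_pos assms(1,2) v by simp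
    have "v mod 4 = y mod 4" using denominator_mod_4 v by simp
    with assms(3) show "4 dvd v" by presburger
  qed
  have "u * t' - s' * v = (a * d - b * c) * (x * t - s * y)"
    unfolding u v s'_def t'_def by (simp add: algebra_simps)
  then have det': "u * t' - s' * v = 1" using st det by simp
  note xy = kronecker_eq_second_column[OF assms(2,3) st(2,3)]
  note uv = kronecker_eq_second_column[OF v4 t'(1) det']
  show "kronecker u v = kronecker x y" if "x mod 4 = 1"
    using xy uv inv t' xt that by simp
  show "kronecker u v = - kronecker (-1) v"
    if "x mod 4 = 3" "kronecker x y = - kronecker (-1) y"
  proof -
    \<comment> \<open>Here \<open>t\<close> is 3 modulo 4, so the formula carries the factor
      \<open>- kronecker (-1) y\<close>; cancelling this unit leaves
      \<open>kronecker s t = 1\<close>.\<close>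
    have "kronecker (-1) y * kronecker s t = kronecker (-1) y"
      using xy xt that by simp
    then have "kronecker s t = 1"
      using kronecker_minus_one_square[OF assms(2)] by auto
    then show ?thesis using uv inv t' xt that by simp
  qed
qed

end

lemma Psi_matrix_of_mem:
  assumes "A \<in> Psi"
  shows "Psi_matrix (A $ 1 $ 1) (A $ 1 $ 2) (A $ 2 $ 1) (A $ 2 $ 2)"
  using assms unfolding Psi_def nonneg_part_def Gamma1_4_def SL2Z_def
  by unfold_locales (auto simp: det_2)

theorem theorem2p5:
  fixes x y :: int
  assumes "x \<ge> 0" and "y \<ge> 0" and "coprime x y"
    and "(odd y \<and> kronecker x y = -1) \<or>
         ([x = 1] (mod 4) \<and> [y = 0] (mod 4) \<and> kronecker x y = -1) \<or>
         ([x = 3] (mod 4) \<and> [y = 0] (mod 4) \<and> kronecker x y = - kronecker (-1) y)"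
  shows "\<forall>w \<in> orbit Psi (vector [x, y]).
           \<not> is_square (numerator w) \<and> \<not> is_square (denominator w)"
proof
  fix w assume "w \<in> orbit Psi (vector [x, y])"
  then obtain A where A: "A \<in> Psi" "w = A *v vector [x, y]" by (auto simp: orbit_def)
  define a b c d where "a = A $ 1 $ 1" and "b = A $ 1 $ 2" and "c = A $ 2 $ 1" and "d = A $ 2 $ 2"
  interpret Psi_matrix a b c d
    unfolding a_def b_def c_def d_def using A(1) by (rule Psi_matrix_of_mem)
  define u v where "u = a * x + b * y" and "v = c * x + d * y"
  have w: "numerator w = u" "denominator w = v"
    by (simp_all add: A(2) numerator_def denominator_def matrix_vector_mult_def sum_2
        a_def b_def c_def d_def u_def v_def)
  \<comment> \<open>For \<open>y = 0\<close> coprimality forces \<open>x = 1\<close>; the default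
    \<open>kronecker 1 0 = 1\<close> and \<open>x\<close> not being 3 modulo 4 rule out all three
    cases.\<close>
  have "y \<noteq> 0"
  proof
    assume "y = 0"
    with assms(1,3) have "x = 1" by simp
    with \<open>y = 0\<close> assms(4) show False by (auto simp: kronecker_def cong_def)
  qed
  with assms(2) have "y > 0" by simp
  with assms(1) have "v > 0" using denominator_pos by (simp add: v_def)
  have squares: "kronecker u v \<ge> 0" if "is_square u \<or> is_square v"
    using that kronecker_square_left_nonneg[OF \<open>v > 0\<close>, of u]
      kronecker_square_right_nonneg[OF \<open>v > 0\<close>, of u] by blast
  from assms(4) consider "odd y" "kronecker x y = -1"
    | "x mod 4 = 1" "4 dvd y" "kronecker x y = -1"
    | "x mod 4 = 3" "4 dvd y" "kronecker x y = - kronecker (-1) y"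
  proof -
    have "[x = 1] (mod 4) \<longleftrightarrow> x mod 4 = 1" "[x = 3] (mod 4) \<longleftrightarrow> x mod 4 = 3"
      by (simp_all add: cong_def)
    with assms(4) that show thesis unfolding cong_0_iff by blast
  qed
  then have "\<not> is_square u \<and> \<not> is_square v"
  proof cases
    case 1
    then have "kronecker u v = -1"
      using kronecker_invariant[OF assms(1,2)] by (simp add: u_def v_def)
    with squares show ?thesis by auto
  next
    case 2
    then have "x > 0" using assms(1) by (cases "x = 0") auto
    with 2 have "kronecker u v = -1"
      using kronecker_orbit_four_dvd(1) \<open>y > 0\<close> assms(3) u_def v_def by simp
    with squares show ?thesis by auto
  next
    case 3
    then have "x > 0" using assms(1) by (cases "x = 0") auto
    with 3 have uv: "kronecker u v = - kronecker (-1) v"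
      using kronecker_orbit_four_dvd(2) \<open>y > 0\<close> assms(3) u_def v_def by simp
    \<comment> \<open>The sign of \<open>kronecker u v\<close> is not fixed in this case, so the
      numerator is excluded by being 3 modulo 4.\<close>
    have "\<not> is_square u"
      using square_mod_4 numerator_mod_4[OF 3(2)] 3(1) u_def by metis
    moreover have "\<not> is_square v"
    proof
      assume "is_square v"
      \<comment> \<open>For a square \<open>v\<close> both \<open>kronecker (-1) v\<close> and its
        negative \<open>kronecker u v\<close> are nonnegative, which contradicts
        \<open>kronecker (-1) v\<close> being a unit.\<close>
      then have "kronecker (-1) v = 0"
        using kronecker_square_right_nonneg[OF \<open>v > 0\<close>, of "-1"] squares uv by simp
      with kronecker_minus_one_square[OF \<open>v > 0\<close>] show False by simp
    qed
    ultimately show ?thesis by simp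
  qed
  with w show "\<not> is_square (numerator w) \<and> \<not> is_square (denominator w)" by simp
qed

end
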